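(* Let $\mathbf{k}$ be a commutative ring with unit. The quadruple $(H_{\rm LR}^{\epsilon},\backslash,|,\Delta_{\rm LR}^{\epsilon})$, where $H_{\rm LR}^{\epsilon}=\mathbf{k}\mathcal{Y}$ is the free $\mathbf{k}$-module on planar binary trees, $\backslash$ is the under product, $|$ is the trivial tree, and $\Delta_{\rm LR}^{\epsilon}$ is the recursively defined infinitesimal coproduct, is a unitary infinitesimal bialgebra (of weight zero).
   Context: All modules, tensor products and linear maps are over $\mathbf{k}$. Planar binary trees: a planar binary tree is a finite rooted planar tree in which every internal vertex has exactly two ordered incoming branches (left and right). The trivial tree, with no internal vertices, is denoted $|$. Let $\mathcal{Y}$ be the set of planar binary trees and $H_{\rm LR}^{\epsilon}:=\mathbf{k}\mathcal{Y}$. Grafting: for $T_l,T_r\in\mathcal{Y}$, $T_l\vee T_r$ is the tree obtained by creating a new root with left branch $T_l$ and right branch $T_r$; $\vee$ is extended bilinearly to $H_{\rm LR}^{\epsilon}$. Every $T\in\mathcal{Y}$ with $T\neq |$ is uniquely of the form $T=T_l\vee T_r$ with $T_l,T_r\in\mathcal Y$. Under product: the bilinear map $\backslash$ on $H_{\rm LR}^{\epsilon}$ where, for trees $S,T$, $S\backslash T$ is obtained by adjoining the root of $T$ to the rightmost branch of $S$; recursively, $|\backslash T=T$ and $(S_l\vee S_r)\backslash T=S_l\vee(S_r\backslash T)$. The unit is $|$. Infinitesimal coproduct: the linear map $\Delta_{\rm LR}^{\epsilon}:H_{\rm LR}^{\epsilon}\to H_{\rm LR}^{\epsilon}\otimes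 H_{\rm LR}^{\epsilon}$ defined on trees recursively by $\Delta_{\rm LR}^{\epsilon}(|)=0$ and $$\Delta_{\rm LR}^{\epsilon}(T_l\vee T_r)=T_l\otimes T_r+(\mathrm{id}\otimes\vee)(\Delta_{\rm LR}^{\epsilon}(T_l)\otimes T_r)+(\vee\otimes\mathrm{id})(T_l\otimes\Delta_{\rm LR}^{\epsilon}(T_r)).$$ A unitary infinitesimal bialgebra (of weight zero) is a quadruple $(A,\cdot,1_A,\Delta)$ where $(A,\cdot,1_A)$ is a unitary associative algebra and $\Delta:A\to A\otimes A$ is a coassociative linear map (a counit is not required) such that $\Delta(ab)=a\cdot\Delta(b)+\Delta(a)\cdot b$ for all $a,b\in A$, where $a\cdot(u\otimes v)=(au)\otimes v$ and $(u\otimes v)\cdot b=u\otimes(vb)$. *)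

theory Defs
  imports Complex_Main "HOL-Library.Poly_Mapping"
begin

section \<open>Free modules\<close>

text \<open>The free \<open>'k\<close>-module on a set \<open>'x\<close> is the type \<open>'x \<Rightarrow>\<^sub>0 'k\<close> of finitely supported functions,
  with the following scalar multiplication.\<close>

definition fscale :: "'k::comm_ring_1 \<Rightarrow> ('x \<Rightarrow>\<^sub>0 'k) \<Rightarrow> ('x \<Rightarrow>\<^sub>0 'k)"
  where "fscale c p = Poly_Mapping.map ((*) c) p"

definition basis :: "'x \<Rightarrow> ('x \<Rightarrow>\<^sub>0 'k::comm_ring_1)"
  where "basis x = Poly_Mapping.single x 1"

text \<open>Linear extension of a map \<open>f\<close> from basis elements into a module with scalar multiplication
  \<open>s\<close>, and the bilinear analogue for free modules.\<close>

definition lin_ext ::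
    "('k::comm_ring_1 \<Rightarrow> 'm \<Rightarrow> 'm) \<Rightarrow> ('x \<Rightarrow> 'm) \<Rightarrow> ('x \<Rightarrow>\<^sub>0 'k) \<Rightarrow> 'm::ab_group_add"
  where "lin_ext s f p = (\<Sum>x\<in>Poly_Mapping.keys p. s (Poly_Mapping.lookup p x) (f x))"

definition bilin_ext ::
    "('x \<Rightarrow> 'y \<Rightarrow> ('z \<Rightarrow>\<^sub>0 'k)) \<Rightarrow> ('x \<Rightarrow>\<^sub>0 'k) \<Rightarrow> ('y \<Rightarrow>\<^sub>0 'k) \<Rightarrow> ('z \<Rightarrow>\<^sub>0 'k::comm_ring_1)"
  where "bilin_ext f u v = lin_ext fscale (\<lambda>x. lin_ext fscale (f x) v) u"

lemma lookup_fscale [simp]: "Poly_Mapping.lookup (fscale c p) x = c * Poly_Mapping.lookup p x"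
  unfolding fscale_def by (transfer) (auto simp: when_def)

lemma module_fscale: "module (fscale :: 'k::comm_ring_1 \<Rightarrow> ('x \<Rightarrow>\<^sub>0 'k) \<Rightarrow> _)"
  by unfold_locales
    (auto intro!: poly_mapping_eqI simp: Poly_Mapping.lookup_add algebra_simps)

lemma lin_ext_superset:
  assumes "module s" "finite A" "Poly_Mapping.keys p \<subseteq> A"
  shows "lin_ext s f p = (\<Sum>x\<in>A. s (Poly_Mapping.lookup p x) (f x))"
proof -
  interpret module s by fact
  show ?thesis unfolding lin_ext_def
    by (rule sum.mono_neutral_left) (use assms in \<open>auto simp: in_keys_iff\<close>)
qed

lemma module_hom_lin_ext:
  assumes "module s"
  shows "module_hom fscale s (lin_ext s f)"
proof -
  interpret m: module s by fact
  show ?thesis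
    unfolding module_hom_iff
  proof (intro conjI allI)
    show "module fscale" by (rule module_fscale)
    show "module s" by fact
    fix p q :: "'c \<Rightarrow>\<^sub>0 'a"
    let ?A = "Poly_Mapping.keys p \<union> Poly_Mapping.keys q"
    have "Poly_Mapping.keys (p + q) \<subseteq> ?A" by (rule Poly_Mapping.keys_add)
    then show "lin_ext s f (p + q) = lin_ext s f p + lin_ext s f q"
      by (simp add: lin_ext_superset[OF assms, of ?A] lookup_add m.scale_left_distrib sum.distrib)
  next
    fix c and p :: "'c \<Rightarrow>\<^sub>0 'a"
    have "Poly_Mapping.keys (fscale c p) \<subseteq> Poly_Mapping.keys p" by (auto simp: in_keys_iff)
    then show "lin_ext s f (fscale c p) = s c (lin_ext s f p)"
      by (simp add: lin_ext_superset[OF assms, of "Poly_Mapping.keys p"] m.scale_sum_right)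
  qed
qed

lemma lin_ext_basis [simp]:
  assumes "module s"
  shows "lin_ext s f (basis x) = f x"
proof -
  interpret m: module s by fact
  show ?thesis by (simp add: lin_ext_superset[OF assms, of "{x}"] basis_def)
qed

lemma lin_ext_basis_id: "lin_ext fscale basis p = p"
proof (rule poly_mapping_eqI)
  fix x
  show "Poly_Mapping.lookup (lin_ext fscale basis p) x = Poly_Mapping.lookup p x"
    by (simp add: lin_ext_def lookup_sum basis_def lookup_single when_def in_keys_iff
      if_distrib[of "\<lambda>a. _ * a"] cong: if_cong)
qed

lemma module_hom_lin_ext_comp:
  assumes "module_hom s t h"
  shows "h (lin_ext s f p) = lin_ext t (\<lambda>x. h (f x)) p"
proof -
  interpret module_hom s t h by fact
  show ?thesis by (simp add: lin_ext_def sum scale)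
qed

lemma module_hom_fscale_eqI:
  assumes "module_hom fscale s f" "module_hom fscale s g" "\<And>x. f (basis x) = g (basis x)"
  shows "f p = g p"
  using module_hom_lin_ext_comp[where f = basis and p = p, OF assms(1)]
    module_hom_lin_ext_comp[where f = basis and p = p, OF assms(2)]
  by (simp add: lin_ext_basis_id assms(3))

lemma fscale_submodule_UNIV:
  assumes "module.subspace fscale S" "\<And>x. basis x \<in> S"
  shows "p \<in> S"
proof -
  interpret F: module "fscale :: 'a \<Rightarrow> ('b \<Rightarrow>\<^sub>0 'a) \<Rightarrow> _" by (rule module_fscale)
  have "lin_ext fscale basis p \<in> S"
    unfolding lin_ext_def by (intro F.subspace_sum F.subspace_scale assms)
  then show ?thesis by (simp add: lin_ext_basis_id)
qed


section \<open>Tensor products of modules\<close>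

text \<open>The generators of the submodule \<open>R\<close> of the free module on \<open>'a \<times> 'b\<close> for which
  \<open>A \<otimes> B\<close> is the quotient by \<open>R\<close>.\<close>

definition tensor_relations ::
    "('k::comm_ring_1 \<Rightarrow> 'a::ab_group_add \<Rightarrow> 'a) \<Rightarrow> ('k \<Rightarrow> 'b::ab_group_add \<Rightarrow> 'b)
      \<Rightarrow> (('a \<times> 'b) \<Rightarrow>\<^sub>0 'k) set"
  where "tensor_relations sA sB =
     {basis (a + a', b) - basis (a, b) - basis (a', b) | a a' b. True}
   \<union> {basis (a, b + b') - basis (a, b) - basis (a, b') | a b b'. True}
   \<union> {basis (sA c a, b) - fscale c (basis (a, b)) | a b c. True}
   \<union> {basis (a, sB c b) - fscale c (basis (a, b)) | a b c. True}"

text \<open>A tensor product of \<open>A\<close> and \<open>B\<close> is given by a module \<open>T\<close> and a map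
  \<open>tens :: 'a \<Rightarrow> 'b \<Rightarrow> 't\<close> such that the induced linear map from the free module on \<open>'a \<times> 'b\<close> to \<open>T\<close>
  is onto and its kernel is the submodule \<open>R\<close>; that is, \<open>tens\<close> identifies \<open>T\<close> with the quotient.
  The type of \<open>T\<close> is a parameter, because a HOL type cannot depend on the scalar multiplications
  \<open>sA\<close> and \<open>sB\<close>.\<close>

locale tensor_product = A: module sA + B: module sB + T: module sT
  for sA :: "'k::comm_ring_1 \<Rightarrow> 'a::ab_group_add \<Rightarrow> 'a"
  and sB :: "'k \<Rightarrow> 'b::ab_group_add \<Rightarrow> 'b"
  and sT :: "'k \<Rightarrow> 't::ab_group_add \<Rightarrow> 't" +
  fixes tens :: "'a \<Rightarrow> 'b \<Rightarrow> 't"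
  assumes surj_tens: "surj (lin_ext sT (\<lambda>(a, b). tens a b))"
    and kernel_tens:
      "{u. lin_ext sT (\<lambda>(a, b). tens a b) u = 0} = module.span fscale (tensor_relations sA sB)"
begin

text \<open>The linear map on \<open>T\<close> determined by its values \<open>f a b\<close> on pure tensors, for bilinear \<open>f\<close>.
  It is well defined by \<open>lift_unique\<close> below.\<close>

definition lift :: "('k \<Rightarrow> 'm::ab_group_add \<Rightarrow> 'm) \<Rightarrow> ('a \<Rightarrow> 'b \<Rightarrow> 'm) \<Rightarrow> 't \<Rightarrow> 'm"
  where "lift sM f = (THE g. module_hom sT sM g \<and> (\<forall>a b. g (tens a b) = f a b))"

lemma lift_unique:
  assumes M: "module sM"
    and lin1: "\<And>b. module_hom sA sM (\<lambda>a. f a b)"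
    and lin2: "\<And>a. module_hom sB sM (f a)"
  shows "\<exists>!g. module_hom sT sM g \<and> (\<forall>a b. g (tens a b) = f a b)"
proof -
  let ?p = "lin_ext sT (\<lambda>(a, b). tens a b)" and ?q = "lin_ext sM (\<lambda>(a, b). f a b)"
  interpret F: module "fscale :: 'k \<Rightarrow> ('a \<times> 'b \<Rightarrow>\<^sub>0 'k) \<Rightarrow> _" by (rule module_fscale)
  interpret p: module_hom fscale sT ?p by (rule module_hom_lin_ext) unfold_locales
  interpret q: module_hom fscale sM ?q by (rule module_hom_lin_ext) fact
  interpret M: module sM by fact
  have p_basis: "?p (basis (a, b)) = tens a b" for a b
    by (simp add: T.module_axioms)
  have q_basis: "?q (basis (a, b)) = f a b" for a b
    by (simp add: M)
  have "F.span (tensor_relations sA sB) \<subseteq> {u. ?q u = 0}"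
  proof (rule F.span_minimal)
    show "F.subspace {u. ?q u = 0}" by (rule q.subspace_kernel)
    show "tensor_relations sA sB \<subseteq> {u. ?q u = 0}"
      using module_hom.add[OF lin1] module_hom.add[OF lin2]
        module_hom.scale[OF lin1] module_hom.scale[OF lin2]
      by (auto simp: tensor_relations_def q.diff q.scale q_basis)
  qed
  then have ker: "?q u = 0" if "?p u = 0" for u
    using that kernel_tens by auto
  have q_eq: "?q u = ?q v" if "?p u = ?p v" for u v
    using ker[of "u - v"] that by (simp add: p.diff q.diff)
  define g where "g t = ?q (inv ?p t)" for t
  have g: "g (?p u) = ?q u" for u
    unfolding g_def by (rule q_eq) (simp add: surj_f_inv_f[OF surj_tens])
  have "module_hom sT sM g"
    unfolding module_hom_iff
  proof (intro conjI allI)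
    fix t t' c
    obtain u v where "t = ?p u" "t' = ?p v" using surj_tens by (metis surjD)
    then show "g (t + t') = g t + g t'" "g (sT c t) = sM c (g t)"
      by (simp_all add: g q.add q.scale flip: p.add p.scale)
  qed unfold_locales
  moreover have "g (tens a b) = f a b" for a b
    using g[of "basis (a, b)"] by (simp only: p_basis q_basis)
  moreover have "h = g" if h: "module_hom sT sM h" "\<forall>a b. h (tens a b) = f a b" for h
  proof
    fix t
    obtain u where u: "t = ?p u" using surj_tens by (metis surjD)
    have "h (?p u) = lin_ext sM (\<lambda>x. h ((\<lambda>(a, b). tens a b) x)) u"
      by (rule module_hom_lin_ext_comp[OF h(1)])
    also have "(\<lambda>x. h ((\<lambda>(a, b). tens a b) x)) = (\<lambda>(a, b). f a b)"
      using h(2) by auto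
    finally show "h t = g t" by (simp add: u g)
  qed
  ultimately show ?thesis by blast
qed

end

text \<open>For free modules, the free module on the product of the bases is a tensor product.\<close>

definition ftens :: "('x \<Rightarrow>\<^sub>0 'k) \<Rightarrow> ('y \<Rightarrow>\<^sub>0 'k) \<Rightarrow> ('x \<times> 'y \<Rightarrow>\<^sub>0 'k::comm_ring_1)"
  where "ftens = bilin_ext (\<lambda>x y. basis (x, y))"

lemma bilin_ext_basis [simp]: "bilin_ext f (basis x) (basis y) = f x y"
  by (simp add: bilin_ext_def module_fscale)

lemma module_hom_bilin_ext_left: "module_hom fscale fscale (\<lambda>u. bilin_ext f u v)"
  unfolding bilin_ext_def by (rule module_hom_lin_ext[OF module_fscale])

lemma module_hom_bilin_ext_right:
  fixes f :: "'x \<Rightarrow> 'y \<Rightarrow> ('z \<Rightarrow>\<^sub>0 'k::comm_ring_1)"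
  shows "module_hom fscale fscale (bilin_ext f u)"
proof -
  have eq: "bilin_ext f u = (\<lambda>v. \<Sum>x\<in>Poly_Mapping.keys u.
      fscale (Poly_Mapping.lookup u x) (lin_ext fscale (f x) v))"
    by (simp add: fun_eq_iff bilin_ext_def lin_ext_def[of fscale _ u])
  interpret module_pair "fscale :: 'k \<Rightarrow> ('y \<Rightarrow>\<^sub>0 'k) \<Rightarrow> _" "fscale :: 'k \<Rightarrow> ('z \<Rightarrow>\<^sub>0 'k) \<Rightarrow> _"
    by (simp add: module_pair_def module_fscale)
  show ?thesis unfolding eq
    by (intro module_hom_sum module_hom_scale module_hom_lin_ext conjI module_fscale)
qed

lemma tensor_product_ftens:
  "tensor_product fscale fscale fscale
    (ftens :: ('x \<Rightarrow>\<^sub>0 'k) \<Rightarrow> ('y \<Rightarrow>\<^sub>0 'k) \<Rightarrow> ('x \<times> 'y \<Rightarrow>\<^sub>0 'k::comm_ring_1))"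
proof -
  let ?tens = "ftens :: ('x \<Rightarrow>\<^sub>0 'k) \<Rightarrow> ('y \<Rightarrow>\<^sub>0 'k) \<Rightarrow> ('x \<times> 'y \<Rightarrow>\<^sub>0 'k)"
  define p where "p = lin_ext fscale (\<lambda>(a, b). ?tens a b)"
  define j :: "('x \<times> 'y \<Rightarrow>\<^sub>0 'k) \<Rightarrow> (('x \<Rightarrow>\<^sub>0 'k) \<times> ('y \<Rightarrow>\<^sub>0 'k) \<Rightarrow>\<^sub>0 'k)"
    where "j = lin_ext fscale (\<lambda>(x, y). basis (basis x, basis y))"
  define R where "R = tensor_relations (fscale :: 'k \<Rightarrow> ('x \<Rightarrow>\<^sub>0 'k) \<Rightarrow> _) (fscale :: 'k \<Rightarrow> ('y \<Rightarrow>\<^sub>0 'k) \<Rightarrow> _)"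
  interpret p: module_hom fscale fscale p
    unfolding p_def by (rule module_hom_lin_ext[OF module_fscale])
  interpret j: module_hom fscale fscale j
    unfolding j_def by (rule module_hom_lin_ext[OF module_fscale])
  interpret t1: module_hom fscale fscale "\<lambda>a. ?tens a b" for b
    unfolding ftens_def by (rule module_hom_bilin_ext_left)
  interpret t2: module_hom fscale fscale "?tens a" for a
    unfolding ftens_def by (rule module_hom_bilin_ext_right)
  have p_basis [simp]: "p (basis (a, b)) = ?tens a b" for a b
    by (simp add: p_def module_fscale)
  have j_basis [simp]: "j (basis (x, y)) = basis (basis x, basis y)" for x y
    by (simp add: j_def module_fscale)
  have tens_basis [simp]: "?tens (basis x) (basis y) = basis (x, y)" for x y
    by (simp add: ftens_def)
  have pj: "p (j t) = t" for t
  proof -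
    have "module_hom fscale fscale (p \<circ> j)"
      by (rule module_hom_compose[OF j.module_hom_axioms p.module_hom_axioms])
    moreover have "module_hom fscale fscale (id :: ('x \<times> 'y \<Rightarrow>\<^sub>0 'k) \<Rightarrow> _)"
      by (rule p.m2.module_hom_id)
    ultimately have "(p \<circ> j) t = id t"
      by (rule module_hom_fscale_eqI) auto
    then show ?thesis by simp
  qed
  have "p.m1.span R \<subseteq> {u. p u = 0}"
  proof (rule p.m1.span_minimal)
    show "p.m1.subspace {u. p u = 0}" by (rule p.subspace_kernel)
    show "R \<subseteq> {u. p u = 0}"
      by (auto simp: R_def tensor_relations_def p.diff p.scale t1.add t2.add t1.scale t2.scale)
  qed
  moreover have "{u. p u = 0} \<subseteq> p.m1.span R"
  proof -
    have rel: "basis (a + a', b) - basis (a, b) - basis (a', b) \<in> p.m1.span R"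
        "basis (a, b + b') - basis (a, b) - basis (a, b') \<in> p.m1.span R"
        "basis (fscale c a, b) - fscale c (basis (a, b)) \<in> p.m1.span R"
        "basis (a, fscale c b) - fscale c (basis (a, b)) \<in> p.m1.span R" for a a' b b' c
      unfolding R_def by (rule p.m1.span_base, force simp: tensor_relations_def)+
    define D where "D a b = basis (a, b) - j (?tens a b)" for a b
    have D_add: "D (a + a') b \<in> p.m1.span R" if "D a b \<in> p.m1.span R" "D a' b \<in> p.m1.span R" for a a' b
    proof -
      have "D (a + a') b = D a b + D a' b + (basis (a + a', b) - basis (a, b) - basis (a', b))"
        by (simp add: D_def t1.add j.add)
      then show ?thesis using that rel by (simp add: p.m1.span_add)
    qed
    have D_add': "D a (b + b') \<in> p.m1.span R" if "D a b \<in> p.m1.span R" "D a b' \<in> p.m1.span R" for a b b'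
    proof -
      have "D a (b + b') = D a b + D a b' + (basis (a, b + b') - basis (a, b) - basis (a, b'))"
        by (simp add: D_def t2.add j.add)
      then show ?thesis using that rel by (simp add: p.m1.span_add)
    qed
    have D_scale: "D (fscale c a) b \<in> p.m1.span R" if "D a b \<in> p.m1.span R" for a b c
    proof -
      have "D (fscale c a) b = fscale c (D a b) + (basis (fscale c a, b) - fscale c (basis (a, b)))"
        by (simp add: D_def t1.scale j.scale p.m1.scale_right_diff_distrib)
      then show ?thesis using that rel by (simp add: p.m1.span_add p.m1.span_scale)
    qed
    have D_scale': "D a (fscale c b) \<in> p.m1.span R" if "D a b \<in> p.m1.span R" for a b c
    proof -
      have "D a (fscale c b) = fscale c (D a b) + (basis (a, fscale c b) - fscale c (basis (a, b)))"
        by (simp add: D_def t2.scale j.scale p.m1.scale_right_diff_distrib)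
      then show ?thesis using that rel by (simp add: p.m1.span_add p.m1.span_scale)
    qed
    have D_0: "D 0 b \<in> p.m1.span R" "D a 0 \<in> p.m1.span R" for a b
      using rel(1)[of 0 0 b] rel(2)[of a 0 0] p.m1.span_neg
      by (fastforce simp: D_def t1.zero t2.zero j.zero)+
    have D_basis: "D (basis x) (basis y) \<in> p.m1.span R" for x y
      by (simp add: D_def p.m1.span_zero)
    have D1: "D (basis x) b \<in> p.m1.span R" for x b
      using fscale_submodule_UNIV[of "{b. D (basis x) b \<in> p.m1.span R}" b]
      by (simp add: t2.m1.subspace_def D_0 D_add' D_scale' D_basis)
    have D: "D a b \<in> p.m1.span R" for a b
      using fscale_submodule_UNIV[of "{a. D a b \<in> p.m1.span R}" a]
      by (simp add: t1.m1.subspace_def D_0 D_add D_scale D1)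
    have "u - j (p u) \<in> p.m1.span R" for u
    proof -
      have "u \<in> {u. u - j (p u) \<in> p.m1.span R}"
      proof (rule fscale_submodule_UNIV)
        show "p.m1.subspace {u. u - j (p u) \<in> p.m1.span R}"
        proof (rule p.m1.subspaceI; unfold mem_Collect_eq)
          show "0 - j (p 0) \<in> p.m1.span R" by (simp add: p.zero j.zero p.m1.span_zero)
        next
          fix u v assume "u - j (p u) \<in> p.m1.span R" "v - j (p v) \<in> p.m1.span R"
          then have "(u - j (p u)) + (v - j (p v)) \<in> p.m1.span R" by (rule p.m1.span_add)
          then show "u + v - j (p (u + v)) \<in> p.m1.span R"
            by (simp add: p.add j.add algebra_simps)
        next
          fix c u assume "u - j (p u) \<in> p.m1.span R"
          then have "fscale c (u - j (p u)) \<in> p.m1.span R" by (rule p.m1.span_scale)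
          then show "fscale c u - j (p (fscale c u)) \<in> p.m1.span R"
            by (simp add: p.scale j.scale p.m1.scale_right_diff_distrib)
        qed
        show "basis x \<in> {u. u - j (p u) \<in> p.m1.span R}" for x
          using D[of "fst x" "snd x"] by (cases x) (simp add: D_def)
      qed
      then show ?thesis by simp
    qed
    from this[of u for u] show ?thesis by (metis (mono_tags) diff_zero j.zero mem_Collect_eq subsetI)
  qed
  ultimately have "{u. p u = 0} = p.m1.span R" by blast
  moreover have "surj p" by (metis pj surjI)
  ultimately show ?thesis
    by (simp add: tensor_product_def tensor_product_axioms_def module_fscale p_def R_def)
qed


section \<open>Unitary infinitesimal bialgebras\<close>

locale unitary_algebra = module s + monoid mult unit
  for s :: "'k::comm_ring_1 \<Rightarrow> 'a::ab_group_add \<Rightarrow> 'a"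
  and mult :: "'a \<Rightarrow> 'a \<Rightarrow> 'a" and unit :: 'a +
  assumes mult_left_linear: "module_hom s s (\<lambda>a. mult a b)"
    and mult_right_linear: "module_hom s s (mult a)"

text \<open>Here \<open>(s2, tens2)\<close> is a tensor product \<open>A \<otimes> A\<close> and \<open>(s3, tens3)\<close> is a tensor product
  \<open>(A \<otimes> A) \<otimes> A\<close>, which also plays the role of \<open>A \<otimes> (A \<otimes> A)\<close> through
  \<open>a \<otimes> (b \<otimes> c) = (a \<otimes> b) \<otimes> c\<close>.\<close>

locale unitary_infinitesimal_bialgebra =
  unitary_algebra s mult unit +
  AA: tensor_product s s s2 tens2 +
  AAA: tensor_product s2 s s3 tens3
  for s :: "'k::comm_ring_1 \<Rightarrow> 'a::ab_group_add \<Rightarrow> 'a"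
  and mult :: "'a \<Rightarrow> 'a \<Rightarrow> 'a" and unit :: 'a
  and s2 :: "'k \<Rightarrow> 'aa::ab_group_add \<Rightarrow> 'aa" and tens2 :: "'a \<Rightarrow> 'a \<Rightarrow> 'aa"
  and s3 :: "'k \<Rightarrow> 'aaa::ab_group_add \<Rightarrow> 'aaa" and tens3 :: "'aa \<Rightarrow> 'a \<Rightarrow> 'aaa" +
  fixes \<Delta> :: "'a \<Rightarrow> 'aa"
  assumes comult_linear: "module_hom s s2 \<Delta>"
    and coassoc:
      "AA.lift s3 (\<lambda>a b. tens3 (\<Delta> a) b) (\<Delta> x) =
       AA.lift s3 (\<lambda>a b. AA.lift s3 (\<lambda>b' c. tens3 (tens2 a b') c) (\<Delta> b)) (\<Delta> x)"
    and comult_mult: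
      "\<Delta> (mult a b) =
        AA.lift s2 (\<lambda>u v. tens2 (mult a u) v) (\<Delta> b) +
        AA.lift s2 (\<lambda>u v. tens2 u (mult v b)) (\<Delta> a)"


section \<open>Planar binary trees\<close>

datatype pbtree = Triv | Graft pbtree pbtree

definition graft ::
    "(pbtree \<Rightarrow>\<^sub>0 'k) \<Rightarrow> (pbtree \<Rightarrow>\<^sub>0 'k) \<Rightarrow> (pbtree \<Rightarrow>\<^sub>0 'k::comm_ring_1)"
  where "graft = bilin_ext (\<lambda>S T. basis (Graft S T))"

primrec under_tree :: "pbtree \<Rightarrow> pbtree \<Rightarrow> pbtree" where
  "under_tree Triv T = T"
| "under_tree (Graft Sl Sr) T = Graft Sl (under_tree Sr T)"

definition under ::
    "(pbtree \<Rightarrow>\<^sub>0 'k) \<Rightarrow> (pbtree \<Rightarrow>\<^sub>0 'k) \<Rightarrow> (pbtree \<Rightarrow>\<^sub>0 'k::comm_ring_1)"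
  where "under = bilin_ext (\<lambda>S T. basis (under_tree S T))"

text \<open>The linear maps \<open>id \<otimes> \<or>\<close> and \<open>\<or> \<otimes> id\<close>, each defined on the bracketing of the threefold tensor
  product in which its argument occurs in the recursion for the coproduct.\<close>

definition id_tens_graft ::
    "((pbtree \<times> pbtree) \<times> pbtree \<Rightarrow>\<^sub>0 'k) \<Rightarrow> (pbtree \<times> pbtree \<Rightarrow>\<^sub>0 'k::comm_ring_1)"
  where "id_tens_graft =
    lin_ext fscale (\<lambda>((a, b), c). ftens (basis a) (graft (basis b) (basis c)))"

definition graft_tens_id ::
    "(pbtree \<times> (pbtree \<times> pbtree) \<Rightarrow>\<^sub>0 'k) \<Rightarrow> (pbtree \<times> pbtree \<Rightarrow>\<^sub>0 'k::comm_ring_1)"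
  where "graft_tens_id =
    lin_ext fscale (\<lambda>(a, (b, c)). ftens (graft (basis a) (basis b)) (basis c))"

primrec \<Delta>_tree :: "pbtree \<Rightarrow> (pbtree \<times> pbtree \<Rightarrow>\<^sub>0 'k::comm_ring_1)" where
  "\<Delta>_tree Triv = 0"
| "\<Delta>_tree (Graft Tl Tr) =
     ftens (basis Tl) (basis Tr)
   + id_tens_graft (ftens (\<Delta>_tree Tl) (basis Tr))
   + graft_tens_id (ftens (basis Tl) (\<Delta>_tree Tr))"

definition \<Delta>_LR :: "(pbtree \<Rightarrow>\<^sub>0 'k) \<Rightarrow> (pbtree \<times> pbtree \<Rightarrow>\<^sub>0 'k::comm_ring_1)"
  where "\<Delta>_LR = lin_ext fscale \<Delta>_tree"

end

theory Submission
  imports Defs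
begin

text \<open>An internal vertex \<open>v\<close> of a tree \<open>T\<close> determines a cut of \<open>T\<close>: the path from the root to \<open>v\<close>
  divides \<open>T\<close> into a left tree, whose vertices come before \<open>v\<close> in the in-order, and a right tree,
  whose vertices come after \<open>v\<close>. The recursion for the infinitesimal coproduct enumerates these cuts.
  At the root of \<open>Graft l r\<close> the cut is \<open>(l, r)\<close>; a cut \<open>(a, b)\<close> of \<open>l\<close> becomes \<open>(a, Graft b r)\<close>;
  and a cut \<open>(a, b)\<close> of \<open>r\<close> becomes \<open>(Graft l a, b)\<close>. So the coproduct of \<open>T\<close> is the sum of
  \<open>a \<otimes> b\<close> over the cuts \<open>(a, b)\<close> of \<open>T\<close>.

  With this picture both axioms say that two ways of cutting agree. For coassociativity
  (\<open>cut_sum_coassoc\<close>), cutting at \<open>w\<close> and then cutting the left part at an earlier \<open>v\<close> leaves the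
  same three trees as cutting at \<open>v\<close> and then the right part at \<open>w\<close>. For the product rule
  (\<open>cut_sum_under_tree\<close>), the vertices of \<open>S\<close> precede those of \<open>T\<close> in \<open>under_tree S T\<close>, and a cut at
  a vertex of one factor leaves the other factor whole, attached on the side where it was.

  Both are proved by induction on trees for sums of an arbitrary function of the parts of a cut
  (\<open>cut_sum\<close>), because the induction passes from one function to another. Associativity of the under
  product is an induction on trees as well. What remains is linear algebra: the axioms concern all
  elements of the free module and maps given by the universal property of the tensor product,
  which \<open>lift_ftens\<close> turns into explicit linear extensions, so that basis elements suffice.\<close>

section \<open>Linear extensions\<close>

lemma lin_ext_add_fun:
  assumes "module s"
  shows "lin_ext s (\<lambda>x. f x + g x) p = lin_ext s f p + lin_ext s g p"
proof -
  interpret module s by fact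
  show ?thesis by (simp add: lin_ext_def scale_right_distrib sum.distrib)
qed

lemma lin_ext_swap:
  assumes "module s"
  shows "lin_ext s (\<lambda>x. lin_ext s (f x) q) p = lin_ext s (\<lambda>y. lin_ext s (\<lambda>x. f x y) p) q"
proof -
  interpret module s by fact
  show ?thesis
    unfolding lin_ext_def scale_sum_right
    by (subst sum.swap) (simp add: mult.commute)
qed

lemma module_hom_lin_ext_param:
  assumes "module s" "\<And>x. module_hom r s (\<lambda>a. f a x)"
  shows "module_hom r s (\<lambda>a. lin_ext s (f a) p)"
proof -
  interpret module_hom r s "\<lambda>a. f a undefined" by (rule assms)
  interpret module_pair r s ..
  show ?thesis
    unfolding lin_ext_def
    by (intro module_hom_sum module_hom_scale assms conjI m1.module_axioms m2.module_axioms)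
qed

lemma bilinear_eqI:
  assumes "\<And>b. module_hom fscale s (\<lambda>a. F a b)" "\<And>a. module_hom fscale s (F a)"
    and "\<And>b. module_hom fscale s (\<lambda>a. G a b)" "\<And>a. module_hom fscale s (G a)"
    and "\<And>x y. F (basis x) (basis y) = G (basis x) (basis y)"
  shows "F a b = G a b"
proof -
  have "F (basis x) b = G (basis x) b" for x
    by (rule module_hom_fscale_eqI[OF assms(2,4,5)])
  then show ?thesis
    by (rule module_hom_fscale_eqI[OF assms(1,3)])
qed

lemma ftens_basis [simp]: "ftens (basis x) (basis y) = basis (x, y)"
  by (simp add: ftens_def)

lemma module_hom_ftens_left: "module_hom fscale fscale (\<lambda>u. ftens u v)"
  unfolding ftens_def by (rule module_hom_bilin_ext_left)

lemma module_hom_ftens_right: "module_hom fscale fscale (ftens u)"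
  unfolding ftens_def by (rule module_hom_bilin_ext_right)

text \<open>Elements of the free module on \<open>'x \<times> 'y\<close> are combinations of the pure tensors of basis
  elements, so a map given by the universal property is determined by what it does there. This makes
  the lifts in the axioms computable.\<close>

lemma lift_ftens:
  assumes s: "module s"
    and f: "\<And>b. module_hom fscale s (\<lambda>a. f a b)" "\<And>a. module_hom fscale s (f a)"
  shows "tensor_product.lift fscale ftens s f = lin_ext s (\<lambda>(x, y). f (basis x) (basis y))"
    (is "_ = ?g")
proof -
  interpret tensor_product fscale fscale fscale ftens by (rule tensor_product_ftens)
  have g: "module_hom fscale s ?g" by (rule module_hom_lin_ext[OF s])
  have "?g (ftens a b) = f a b" for a b
    by (rule bilinear_eqI[where s = s])
      (use module_hom_compose[OF module_hom_ftens_left g] module_hom_compose[OF module_hom_ftens_right g] in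
        \<open>simp_all add: f s comp_def\<close>)
  then show ?thesis
    unfolding lift_def by (intro the1_equality lift_unique s f) (use g in auto)
qed


section \<open>Sums over the cuts of a tree\<close>

text \<open>In Sweedler notation, the sum of \<open>g T\<^sub>1 T\<^sub>2\<close>, where the coproduct of \<open>T\<close> is the sum of
  \<open>T\<^sub>1 \<otimes> T\<^sub>2\<close>. The function \<open>g\<close> is given on trees only, so that statements about \<open>cut_sum\<close> involve
  no linearity condition on \<open>g\<close>.\<close>

definition cut_sum ::
    "('k::comm_ring_1 \<Rightarrow> 'm::ab_group_add \<Rightarrow> 'm) \<Rightarrow> (pbtree \<Rightarrow> pbtree \<Rightarrow> 'm) \<Rightarrow> pbtree \<Rightarrow> 'm"
  where "cut_sum s g T = lin_ext s (\<lambda>(a, b). g a b) (\<Delta>_tree T)"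

lemma id_tens_graft_ftens:
  "id_tens_graft (ftens p (basis r)) = lin_ext fscale (\<lambda>(a, b). basis (a, Graft b r)) p"
proof -
  interpret i: module_hom fscale fscale id_tens_graft
    unfolding id_tens_graft_def by (rule module_hom_lin_ext[OF module_fscale])
  show ?thesis
    by (rule module_hom_fscale_eqI[where s = fscale])
      (use module_hom_compose[OF module_hom_ftens_left i.module_hom_axioms] in
        \<open>auto simp: comp_def module_hom_lin_ext module_fscale id_tens_graft_def graft_def\<close>)
qed

lemma graft_tens_id_ftens:
  "graft_tens_id (ftens (basis l) p) = lin_ext fscale (\<lambda>(a, b). basis (Graft l a, b)) p"
proof -
  interpret i: module_hom fscale fscale graft_tens_id
    unfolding graft_tens_id_def by (rule module_hom_lin_ext[OF module_fscale])
  show ?thesis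
    by (rule module_hom_fscale_eqI[where s = fscale])
      (use module_hom_compose[OF module_hom_ftens_right i.module_hom_axioms] in
        \<open>auto simp: comp_def module_hom_lin_ext module_fscale graft_tens_id_def graft_def\<close>)
qed

lemma cut_sum_Triv: "cut_sum s g Triv = 0"
  by (simp add: cut_sum_def lin_ext_def)

text \<open>The recursion for the coproduct, with the tensors evaluated: a cut is at the root, or inside
  the left branch, or inside the right branch. The inductions below use the coproduct only through
  this equation and its value on the trivial tree.\<close>

lemma cut_sum_Graft:
  assumes s: "module s"
  shows "cut_sum s g (Graft l r) =
    g l r + cut_sum s (\<lambda>a b. g a (Graft b r)) l + cut_sum s (\<lambda>a b. g (Graft l a) b) r"
proof -
  let ?h = "lin_ext s (\<lambda>(a, b). g a b)"
  interpret h: module_hom fscale s ?h by (rule module_hom_lin_ext[OF s])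
  have "?h (lin_ext fscale f p) = lin_ext s (\<lambda>x. ?h (f x)) p"
    for f and p :: "pbtree \<times> pbtree \<Rightarrow>\<^sub>0 'a"
    by (rule module_hom_lin_ext_comp[OF h.module_hom_axioms])
  then show ?thesis
    by (simp add: cut_sum_def id_tens_graft_ftens graft_tens_id_ftens h.add[unfolded split_def] s split_def)
qed

lemma cut_sum_add:
  assumes "module s"
  shows "cut_sum s (\<lambda>a b. f a b + g a b) T = cut_sum s f T + cut_sum s g T"
  using lin_ext_add_fun[OF assms] by (simp add: cut_sum_def split_def)

lemma cut_sum_swap:
  assumes "module s"
  shows "cut_sum s (\<lambda>a b. cut_sum s (\<lambda>c d. g a b c d) T) S =
    cut_sum s (\<lambda>c d. cut_sum s (\<lambda>a b. g a b c d) S) T"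
  unfolding cut_sum_def split_def by (rule lin_ext_swap[OF assms])

lemma module_hom_cut_sum:
  assumes "module_hom s t h"
  shows "h (cut_sum s g T) = cut_sum t (\<lambda>a b. h (g a b)) T"
  unfolding cut_sum_def by (simp add: module_hom_lin_ext_comp[OF assms] split_def)

lemma cut_sum_basis: "cut_sum fscale (\<lambda>a b. basis (a, b)) T = \<Delta>_tree T"
  by (simp add: cut_sum_def lin_ext_basis_id)

text \<open>Both sides run over pairs of vertices \<open>v\<close> before \<open>w\<close>. For \<open>Graft l r\<close>, either both lie in \<open>l\<close>,
  or both in \<open>r\<close> (these are the induction hypotheses, for modified \<open>g\<close>), or one of them is the root,
  or \<open>v\<close> lies in \<open>l\<close> and \<open>w\<close> in \<open>r\<close>. In the last case the two sides sum in different orders,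
  whence the use of \<open>cut_sum_swap\<close>.\<close>

lemma cut_sum_coassoc:
  assumes s: "module s"
  shows "cut_sum s (\<lambda>a c. cut_sum s (\<lambda>a' b. g a' b c) a) T =
    cut_sum s (\<lambda>a b. cut_sum s (\<lambda>b' c. g a b' c) b) T"
proof (induction T arbitrary: g)
  case Triv
  show ?case by (simp add: cut_sum_Triv)
next
  case (Graft l r)
  show ?case
    by (simp add: cut_sum_Graft s cut_sum_add Graft.IH
      cut_sum_swap[OF s, where S = l and T = r] algebra_simps)
qed

text \<open>Since \<open>under_tree\<close> recurses along the right branch of \<open>S\<close>, the cuts at the root and in the left
  branch of \<open>S\<close> only see \<open>T\<close> attached to the right part, and the others are those of the induction
  hypothesis with the left part put back as the right branch of the root of \<open>S\<close>.\<close>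

lemma cut_sum_under_tree:
  assumes s: "module s"
  shows "cut_sum s g (under_tree S T) =
    cut_sum s (\<lambda>u v. g (under_tree S u) v) T + cut_sum s (\<lambda>u v. g u (under_tree v T)) S"
  by (induction S arbitrary: g) (simp_all add: cut_sum_Triv cut_sum_Graft s algebra_simps)


section \<open>The infinitesimal bialgebra\<close>

lemma under_basis [simp]: "under (basis S) (basis T) = basis (under_tree S T)"
  by (simp add: under_def)

lemma module_hom_under_left: "module_hom fscale fscale (\<lambda>a. under a b)"
  unfolding under_def by (rule module_hom_bilin_ext_left)

lemma module_hom_under_right: "module_hom fscale fscale (under a)"
  unfolding under_def by (rule module_hom_bilin_ext_right)

lemma under_tree_Triv_right: "under_tree S Triv = S"
  by (induction S) simp_all

lemma under_tree_assoc: "under_tree (under_tree R S) T = under_tree R (under_tree S T)"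
  by (induction R) simp_all

lemma under_assoc: "under (under a b) c = under a (under b c)"
proof -
  note left = module_hom_compose[OF _ module_hom_under_left, unfolded comp_def]
    and right = module_hom_compose[OF _ module_hom_under_right, unfolded comp_def]
  have "under (under (basis R) b) c = under (basis R) (under b c)" for R
    by (rule bilinear_eqI[where s = fscale])
      (simp_all add: left right module_hom_under_left module_hom_under_right under_tree_assoc)
  then show ?thesis
    by (rule module_hom_fscale_eqI[where s = fscale, rotated 2])
      (simp_all add: left module_hom_under_left)
qed

lemma unitary_algebra_under:
  "unitary_algebra (fscale :: 'k::comm_ring_1 \<Rightarrow> (pbtree \<Rightarrow>\<^sub>0 'k) \<Rightarrow> _) under (basis Triv)"
proof -
  have id: "module_hom fscale fscale (\<lambda>p :: pbtree \<Rightarrow>\<^sub>0 'k. p)"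
    by (rule module.module_hom_ident[OF module_fscale])
  have "under (basis Triv) p = p" "under p (basis Triv) = p" for p :: "pbtree \<Rightarrow>\<^sub>0 'k"
    by (rule module_hom_fscale_eqI[OF _ id];
      simp add: module_hom_under_left module_hom_under_right under_tree_Triv_right)+
  then show ?thesis
    by (simp add: unitary_algebra_def unitary_algebra_axioms_def monoid_def semigroup_def
      monoid_axioms_def module_fscale under_assoc module_hom_under_left module_hom_under_right)
qed

lemma module_hom_\<Delta>_LR: "module_hom fscale fscale \<Delta>_LR"
  unfolding \<Delta>_LR_def by (rule module_hom_lin_ext[OF module_fscale])

lemma \<Delta>_LR_basis [simp]: "\<Delta>_LR (basis T) = \<Delta>_tree T"
  by (simp add: \<Delta>_LR_def module_fscale)

lemma lin_ext_\<Delta>_tree: "lin_ext s (\<lambda>(a, b). g a b) (\<Delta>_tree T) = cut_sum s g T"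
  by (simp add: cut_sum_def)

theorem theorem2p12:
  shows "unitary_infinitesimal_bialgebra
    (fscale :: 'k::comm_ring_1 \<Rightarrow> (pbtree \<Rightarrow>\<^sub>0 'k) \<Rightarrow> (pbtree \<Rightarrow>\<^sub>0 'k))
    under (basis Triv)
    (fscale :: 'k \<Rightarrow> (pbtree \<times> pbtree \<Rightarrow>\<^sub>0 'k) \<Rightarrow> (pbtree \<times> pbtree \<Rightarrow>\<^sub>0 'k)) ftens
    (fscale :: 'k \<Rightarrow> ((pbtree \<times> pbtree) \<times> pbtree \<Rightarrow>\<^sub>0 'k) \<Rightarrow> ((pbtree \<times> pbtree) \<times> pbtree \<Rightarrow>\<^sub>0 'k)) ftens
    \<Delta>_LR"
proof -
  have comp: "module_hom fscale fscale (\<lambda>x. g (f x))"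
    if "module_hom fscale fscale f" "module_hom fscale fscale g"
    for f :: "('x \<Rightarrow>\<^sub>0 'k) \<Rightarrow> ('y \<Rightarrow>\<^sub>0 'k)" and g :: "('y \<Rightarrow>\<^sub>0 'k) \<Rightarrow> ('z \<Rightarrow>\<^sub>0 'k)"
    using module_hom_compose[OF that] by (simp add: comp_def)
  note left = comp[OF _ module_hom_ftens_left]
  note right = comp[OF _ module_hom_ftens_right]
  note ext = module_hom_lin_ext[OF module_fscale]
  note homs = module_hom_\<Delta>_LR module_hom_under_left module_hom_under_right
    module_hom_ftens_left module_hom_ftens_right
  \<comment> \<open>the maps \<open>(a, b) \<mapsto> a \<otimes> \<Delta>(b)\<close>, \<open>(a, b) \<mapsto> a \<cdot> \<Delta>(b)\<close> and \<open>(a, b) \<mapsto> \<Delta>(a) \<cdot> b\<close>,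
    as linear extensions rather than lifts\<close>
  let ?split3 = "\<lambda>a b. lin_ext fscale (\<lambda>(b', c). ftens (ftens a (basis b')) (basis c)) (\<Delta>_LR b)
    :: (pbtree \<times> pbtree) \<times> pbtree \<Rightarrow>\<^sub>0 'k"
  let ?lmul = "\<lambda>a b. lin_ext fscale (\<lambda>(u, v). ftens (under a (basis u)) (basis v)) (\<Delta>_LR b)
    :: pbtree \<times> pbtree \<Rightarrow>\<^sub>0 'k"
  let ?rmul = "\<lambda>a b. lin_ext fscale (\<lambda>(u, v). ftens (basis u) (under (basis v) b)) (\<Delta>_LR a)
    :: pbtree \<times> pbtree \<Rightarrow>\<^sub>0 'k"
  have split3: "module_hom fscale fscale (?split3 a)" "module_hom fscale fscale (\<lambda>a. ?split3 a b)" for a b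
    by (rule comp[OF module_hom_\<Delta>_LR ext])
      (rule module_hom_lin_ext_param[OF module_fscale]; auto intro: left homs)
  have lmul: "module_hom fscale fscale (?lmul a)" "module_hom fscale fscale (\<lambda>a. ?lmul a b)" for a b
    by (rule comp[OF module_hom_\<Delta>_LR ext])
      (rule module_hom_lin_ext_param[OF module_fscale]; auto intro: left homs)
  have rmul: "module_hom fscale fscale (\<lambda>a. ?rmul a b)" "module_hom fscale fscale (?rmul a)" for a b
    by (rule comp[OF module_hom_\<Delta>_LR ext])
      (rule module_hom_lin_ext_param[OF module_fscale]; auto intro: right homs)
  have lift_split3: "tensor_product.lift fscale ftens fscale (\<lambda>b' c. ftens (ftens a b') c) (\<Delta>_LR b) = ?split3 a b"
    for a b
    by (subst lift_ftens) (auto intro: left homs module_fscale)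
  have coassoc: "tensor_product.lift fscale ftens fscale (\<lambda>a b. ftens (\<Delta>_LR a) b) (\<Delta>_LR x) =
      tensor_product.lift fscale ftens fscale
        (\<lambda>a b. tensor_product.lift fscale ftens fscale (\<lambda>b' c. ftens (ftens a b') c) (\<Delta>_LR b)) (\<Delta>_LR x)"
    for x :: "pbtree \<Rightarrow>\<^sub>0 'k"
  proof -
    have "lin_ext fscale (\<lambda>(a, b). ftens (\<Delta>_LR (basis a)) (basis b)) (\<Delta>_LR x) =
        lin_ext fscale (\<lambda>(a, b). ?split3 (basis a) (basis b)) (\<Delta>_LR x)"
    proof (rule module_hom_fscale_eqI[where s = fscale and p = x])
      fix T
      have "ftens (\<Delta>_tree a) (basis c) =
          cut_sum fscale (\<lambda>a' b. basis ((a', b), c) :: (pbtree \<times> pbtree) \<times> pbtree \<Rightarrow>\<^sub>0 'k) a" for a c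
        using module_hom_cut_sum[OF module_hom_ftens_left, of "\<lambda>a b. basis (a, b)" a "basis c"]
        by (simp add: cut_sum_basis)
      then show "lin_ext fscale (\<lambda>(a, b). ftens (\<Delta>_LR (basis a)) (basis b)) (\<Delta>_LR (basis T)) =
          lin_ext fscale (\<lambda>(a, b). ?split3 (basis a) (basis b)) (\<Delta>_LR (basis T))"
        by (simp add: lin_ext_\<Delta>_tree cut_sum_coassoc[OF module_fscale])
    qed (rule comp[OF module_hom_\<Delta>_LR ext])+
    then show ?thesis
      unfolding lift_split3
      by (simp add: lift_ftens[OF module_fscale] left homs split3)
  qed
  have "\<Delta>_LR (under a b) = ?lmul a b + ?rmul a b" for a b
  proof (rule bilinear_eqI[where s = fscale and a = a and b = b])
    have sum: "module_hom fscale fscale (\<lambda>x. f x + g x)"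
      if "module_hom fscale fscale f" "module_hom fscale fscale g"
      for f g :: "(pbtree \<Rightarrow>\<^sub>0 'k) \<Rightarrow> (pbtree \<times> pbtree \<Rightarrow>\<^sub>0 'k)"
      by (rule module_pair.module_hom_add[OF _ that]) (simp add: module_pair_def module_fscale)
    show "module_hom fscale fscale (\<lambda>a. ?lmul a b + ?rmul a b)"
      "module_hom fscale fscale (\<lambda>b. ?lmul a b + ?rmul a b)" for a b
      by (intro sum lmul rmul)+
    show "module_hom fscale fscale (\<lambda>a. \<Delta>_LR (under a b))"
      "module_hom fscale fscale (\<lambda>b. \<Delta>_LR (under a b))" for a b :: "pbtree \<Rightarrow>\<^sub>0 'k"
      by (rule comp[OF module_hom_under_left module_hom_\<Delta>_LR]
        comp[OF module_hom_under_right module_hom_\<Delta>_LR])+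
    show "\<Delta>_LR (under (basis S) (basis T)) = ?lmul (basis S) (basis T) + ?rmul (basis S) (basis T)" for S T
      using cut_sum_under_tree[OF module_fscale, of "\<lambda>a b. basis (a, b)" S T]
      by (simp add: cut_sum_basis lin_ext_\<Delta>_tree)
  qed
  then have comult_mult: "\<Delta>_LR (under a b) =
      tensor_product.lift fscale ftens fscale (\<lambda>u v. ftens (under a u) v) (\<Delta>_LR b) +
      tensor_product.lift fscale ftens fscale (\<lambda>u v. ftens u (under v b)) (\<Delta>_LR a)"
    for a b :: "pbtree \<Rightarrow>\<^sub>0 'k"
    by (simp add: lift_ftens[OF module_fscale] left right homs)
  show ?thesis
    by (intro unitary_infinitesimal_bialgebra.intro unitary_infinitesimal_bialgebra_axioms.intro
      unitary_algebra_under tensor_product_ftens module_hom_\<Delta>_LR coassoc comult_mult)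
qed

end
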